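(* Let $G$ be a split graph without isolated vertices, with degree sequence $\pi$. Then $G$ is unbalanced when $\alpha(\pi)$ and $\beta(\pi)$ have the same length, and $G$ is balanced otherwise.
   Context: Graphs are finite, simple, with at least one vertex. Degree sequences are written in non-increasing order $\pi=(d_1,\dots,d_r)$. The Ferrers diagram $F(\pi)$ has $r$ left-justified rows with $d_i$ boxes in row $i$. $\alpha(\pi)$ is the partition whose parts are the numbers of boxes in each row of $F(\pi)$ lying on or to the right of the main diagonal: its $i$-th part is $d_i-i+1$, for those $i$ with $d_i\ge i$. $\beta(\pi)$ is the partition whose parts are the numbers of boxes in each column of $F(\pi)$ strictly below the main diagonal: its $j$-th part is $|\{i: d_i\ge j\}|-j$, for those $j$ for which this number is positive. The length of a partition is its number of parts. A split graph is a graph $G$ having a $KS$-partition, i.e. a partition $V(G)=K\cup S$ with $K$ a clique and $S$ a stable (independent) set (either may be empty). A $KS$-partition is $K$-max if $|K|$ is the size of a largest clique of $G$, and $S$-max if $|S|$ is the size of a largest stable set of $G$. A split graph is balanced if it has a $KS$-partition that is simultaneously $K$-max and $S$-max, and unbalanced otherwise. *)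

theory Defs
  imports "HOL-Library.Ramsey" "HOL-Library.Multiset"
begin

section \<open>Finite simple graphs\<close>

text \<open>
  A graph is given by its vertex set \<open>V\<close> and its set \<open>E\<close> of edges, which are two-element
  subsets of \<open>V\<close>. Cliques and stable sets are the library's \<^const>\<open>clique\<close> and \<^const>\<open>indep\<close>.
\<close>

definition simple_graph :: "'a set \<Rightarrow> 'a set set \<Rightarrow> bool" where
  "simple_graph V E \<longleftrightarrow> finite V \<and> V \<noteq> {} \<and> E \<subseteq> nsets V 2"

definition degree :: "'a set set \<Rightarrow> 'a \<Rightarrow> nat" where
  "degree E v = card {w. {v, w} \<in> E}"

definition isolated :: "'a set set \<Rightarrow> 'a \<Rightarrow> bool" where
  "isolated E v \<longleftrightarrow> (\<forall>w. {v, w} \<notin> E)"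

definition degree_sequence :: "'a set \<Rightarrow> 'a set set \<Rightarrow> nat list" where
  "degree_sequence V E = rev (sorted_list_of_multiset (image_mset (degree E) (mset_set V)))"

definition clique_number :: "'a set \<Rightarrow> 'a set set \<Rightarrow> nat" where
  "clique_number V E = Max (card ` {C. C \<subseteq> V \<and> clique C E})"

definition stability_number :: "'a set \<Rightarrow> 'a set set \<Rightarrow> nat" where
  "stability_number V E = Max (card ` {I. I \<subseteq> V \<and> indep I E})"


section \<open>Split graphs\<close>

definition KS_partition :: "'a set \<Rightarrow> 'a set set \<Rightarrow> 'a set \<Rightarrow> 'a set \<Rightarrow> bool" where
  "KS_partition V E K S \<longleftrightarrow> K \<union> S = V \<and> K \<inter> S = {} \<and> clique K E \<and> indep S E"

definition split_graph :: "'a set \<Rightarrow> 'a set set \<Rightarrow> bool" where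
  "split_graph V E \<longleftrightarrow> simple_graph V E \<and> (\<exists>K S. KS_partition V E K S)"

definition K_max :: "'a set \<Rightarrow> 'a set set \<Rightarrow> 'a set \<Rightarrow> 'a set \<Rightarrow> bool" where
  "K_max V E K S \<longleftrightarrow> KS_partition V E K S \<and> card K = clique_number V E"

definition S_max :: "'a set \<Rightarrow> 'a set set \<Rightarrow> 'a set \<Rightarrow> 'a set \<Rightarrow> bool" where
  "S_max V E K S \<longleftrightarrow> KS_partition V E K S \<and> card S = stability_number V E"

definition balanced :: "'a set \<Rightarrow> 'a set set \<Rightarrow> bool" where
  "balanced V E \<longleftrightarrow> split_graph V E \<and> (\<exists>K S. K_max V E K S \<and> S_max V E K S)"

definition unbalanced :: "'a set \<Rightarrow> 'a set set \<Rightarrow> bool" where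
  "unbalanced V E \<longleftrightarrow> split_graph V E \<and> \<not> balanced V E"


section \<open>Ferrers diagrams and the partitions above and below the diagonal\<close>

text \<open>
  Rows and columns are numbered from 1, so row \<open>i\<close> has \<open>\<pi> ! (i - 1)\<close> boxes. A box is the
  pair (row, column).
\<close>

definition ferrers :: "nat list \<Rightarrow> (nat \<times> nat) set" where
  "ferrers \<pi> = {(i, j). 1 \<le> i \<and> i \<le> length \<pi> \<and> 1 \<le> j \<and> j \<le> \<pi> ! (i - 1)}"

definition num_columns :: "nat list \<Rightarrow> nat" where
  "num_columns \<pi> = foldr max \<pi> 0"

text \<open>Rows and columns that contribute no box are dropped: the parts of a partition are positive.\<close>

definition alpha :: "nat list \<Rightarrow> nat list" where
  "alpha \<pi> = filter (\<lambda>p. p > 0)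
     (map (\<lambda>i. card {j. (i, j) \<in> ferrers \<pi> \<and> i \<le> j}) [1..<Suc (length \<pi>)])"

definition beta :: "nat list \<Rightarrow> nat list" where
  "beta \<pi> = filter (\<lambda>p. p > 0)
     (map (\<lambda>j. card {i. (i, j) \<in> ferrers \<pi> \<and> j < i}) [1..<Suc (num_columns \<pi>)])"

text \<open>The explicit formulas for the parts.\<close>

lemma alpha_eq:
  "alpha \<pi> = map (\<lambda>i. Suc (\<pi> ! (i - 1)) - i) (filter (\<lambda>i. i \<le> \<pi> ! (i - 1)) [1..<Suc (length \<pi>)])"
proof -
  have *: "card {j. (i, j) \<in> ferrers \<pi> \<and> i \<le> j} = Suc (\<pi> ! (i - 1)) - i"
    if "i \<in> set [1..<Suc (length \<pi>)]" for i
  proof -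
    have "{j. (i, j) \<in> ferrers \<pi> \<and> i \<le> j} = {i..\<pi> ! (i - 1)}"
      using that by (auto simp: ferrers_def)
    then show ?thesis by simp
  qed
  show ?thesis
    unfolding alpha_def filter_map comp_def
  proof (intro map_cong filter_cong refl)
    fix i assume "i \<in> set [1..<Suc (length \<pi>)]"
    from *[OF this]
    show "(0 < card {j. (i, j) \<in> ferrers \<pi> \<and> i \<le> j}) = (i \<le> \<pi> ! (i - 1))"
      by linarith
  next
    fix i assume "i \<in> set (filter (\<lambda>i. i \<le> \<pi> ! (i - 1)) [1..<Suc (length \<pi>)])"
    then have "i \<in> set [1..<Suc (length \<pi>)]"
      by (simp only: set_filter mem_Collect_eq)
    then show "card {j. (i, j) \<in> ferrers \<pi> \<and> i \<le> j} = Suc (\<pi> ! (i - 1)) - i"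
      by (rule *)
  qed
qed

lemma beta_eq:
  assumes "sorted_wrt (\<ge>) \<pi>"
  shows "beta \<pi> = map (\<lambda>j. card {i \<in> {1..length \<pi>}. j \<le> \<pi> ! (i - 1)} - j)
    (filter (\<lambda>j. j < card {i \<in> {1..length \<pi>}. j \<le> \<pi> ! (i - 1)}) [1..<Suc (num_columns \<pi>)])"
proof -
  have *: "card {i. (i, j) \<in> ferrers \<pi> \<and> j < i} = card {i \<in> {1..length \<pi>}. j \<le> \<pi> ! (i - 1)} - j"
    if j: "j \<in> set [1..<Suc (num_columns \<pi>)]" for j
  proof -
    let ?A = "{i \<in> {1..length \<pi>}. j \<le> \<pi> ! (i - 1)}"
    have down: "k \<in> ?A" if "i \<in> ?A" "1 \<le> k" "k \<le> i" for i k
    proof (cases "k = i")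
      case False
      then have "k - 1 < i - 1" "i - 1 < length \<pi>" using that by auto
      with assms have "\<pi> ! (i - 1) \<le> \<pi> ! (k - 1)"
        by (simp only: sorted_wrt_iff_nth_less)
      then show ?thesis using that by simp
    qed (use that in simp)
    have fin: "finite ?A" by simp
    obtain m where m: "?A = {1..m}"
    proof (cases "?A = {}")
      case True
      then show ?thesis using that[of 0] by simp
    next
      case False
      let ?m = "Max ?A"
      have m: "?m \<in> ?A" using False fin by (rule Max_in[rotated])
      have "?A = {1..?m}"
      proof
        show "?A \<subseteq> {1..?m}"
        proof
          fix k assume k: "k \<in> ?A"
          then have "1 \<le> k" by simp
          then show "k \<in> {1..?m}"
            using Max_ge[OF fin k] by (simp only: atLeastAtMost_iff simp_thms)
        qed
        show "{1..?m} \<subseteq> ?A"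
        proof
          fix k assume "k \<in> {1..?m}"
          then have "1 \<le> k" "k \<le> ?m" by (simp_all only: atLeastAtMost_iff)
          then show "k \<in> ?A" by (rule down[OF m])
        qed
      qed
      then show ?thesis by (rule that)
    qed
    have "{i. (i, j) \<in> ferrers \<pi> \<and> j < i} = {i \<in> ?A. j < i}"
      using j by (auto simp: ferrers_def)
    also have "\<dots> = {j<..m}"
      unfolding m by auto
    finally show ?thesis unfolding m by simp
  qed
  show ?thesis
    unfolding beta_def filter_map comp_def
  proof (intro map_cong filter_cong refl)
    fix j assume "j \<in> set [1..<Suc (num_columns \<pi>)]"
    from *[OF this]
    show "(0 < card {i. (i, j) \<in> ferrers \<pi> \<and> j < i}) =
        (j < card {i \<in> {1..length \<pi>}. j \<le> \<pi> ! (i - 1)})"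
      by linarith
  next
    fix j assume "j \<in> set (filter (\<lambda>j. j < card {i \<in> {1..length \<pi>}. j \<le> \<pi> ! (i - 1)})
        [1..<Suc (num_columns \<pi>)])"
    then have "j \<in> set [1..<Suc (num_columns \<pi>)]"
      by (simp only: set_filter mem_Collect_eq)
    then show "card {i. (i, j) \<in> ferrers \<pi> \<and> j < i} =
        card {i \<in> {1..length \<pi>}. j \<le> \<pi> ! (i - 1)} - j"
      by (rule *)
  qed
qed

lemma sorted_degree_sequence: "sorted_wrt (\<ge>) (degree_sequence V E)"
  by (simp add: degree_sequence_def sorted_wrt_rev)

end

theory Submission
  imports Defs
begin

text \<open>
  Let \<open>N j\<close> be the number of vertices of degree at least \<open>j\<close>, which is the height of column \<open>j\<close> of
  the Ferrers diagram. Row \<open>i\<close> reaches the diagonal iff \<open>i \<le> N i\<close>, and column \<open>j\<close> goes below the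
  diagonal iff \<open>j < N j\<close>. So the two partitions have as many parts as there are positive solutions
  of these two inequalities, and the lengths differ by the number of \<open>i \<ge> 1\<close> with \<open>N i = i\<close>.

  Take a KS-partition in which \<open>K\<close> is a largest clique, with \<open>k\<close> vertices
  (\<open>K_max_partition_exists\<close>). Every vertex of \<open>K\<close> has degree at least \<open>k - 1\<close>, and no vertex of \<open>S\<close>
  has degree \<open>k\<close> or more: it would be joined to all of \<open>K\<close> and could be added to it. So \<open>N (k - 1) \<ge> k \<ge> N k\<close>, and because \<open>N\<close> is
  antitone, \<open>\<beta>\<close> has \<open>k - 1\<close> parts, while \<open>\<alpha>\<close> has \<open>k - 1\<close> parts or \<open>k\<close> parts. It has
  \<open>k - 1\<close> exactly when \<open>N k < k\<close>, that is, when some vertex of \<open>K\<close> has degree \<open>k - 1\<close> and hence no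
  neighbour in \<open>S\<close>.

  Such a swing vertex is also what prevents balance. A stable set meets \<open>K\<close> in at most one vertex,
  so a stable set with more vertices than \<open>S\<close> must be \<open>S\<close> together with a swing vertex
  (\<open>stable_side_is_max_iff\<close>). All KS-partitions with a largest clique have stable sides of the
  same size, so it does not matter which of them is examined.
\<close>

section \<open>The lengths of the partitions above and below the diagonal\<close>

text \<open>In a non-increasing list the entries that are at least \<open>j\<close> form an initial segment.\<close>

lemma nth_ge_iff_less_length_filter:
  fixes j :: "'a::order"
  assumes "sorted_wrt (\<ge>) xs"
  shows "i < length xs \<and> j \<le> xs ! i \<longleftrightarrow> i < length (filter (\<lambda>x. j \<le> x) xs)"
  using assms
proof (induction xs arbitrary: i)
  case (Cons x xs)
  show ?case
  proof (cases "j \<le> x")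
    case True
    then show ?thesis using Cons by (cases i) auto
  next
    case False
    then have "\<not> j \<le> y" if "y \<in> set (x # xs)" for y
      using that Cons.prems by (auto dest: order_trans)
    then show ?thesis by (metis filter_False list.size(3) not_less_zero nth_mem)
  qed
qed simp

lemma le_num_columns: "d \<in> set \<pi> \<Longrightarrow> d \<le> num_columns \<pi>"
  unfolding num_columns_def by (induction \<pi>) auto

context
  fixes \<pi> :: "nat list" and N :: "nat \<Rightarrow> nat"
  assumes sorted: "sorted_wrt (\<ge>) \<pi>"
  defines "N \<equiv> \<lambda>j. length (filter (\<lambda>d. j \<le> d) \<pi>)"
begin

lemma ferrers_column: "{i \<in> {1..length \<pi>}. j \<le> \<pi> ! (i - 1)} = {1..N j}"
proof -
  have "1 \<le> i \<and> i \<le> length \<pi> \<and> j \<le> \<pi> ! (i - 1) \<longleftrightarrow> 1 \<le> i \<and> i \<le> N j" for i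
    using nth_ge_iff_less_length_filter[OF sorted, of "i - 1" j] by (auto simp: N_def)
  then show ?thesis by (intro set_eqI) (simp only: mem_Collect_eq atLeastAtMost_iff conj_assoc)
qed

lemma length_alpha: "length (alpha \<pi>) = card {i. 1 \<le> i \<and> i \<le> N i}"
proof -
  have "i \<in> {1..length \<pi>} \<and> i \<le> \<pi> ! (i - 1) \<longleftrightarrow> i \<in> {1..N i}" for i
    unfolding ferrers_column[of i, symmetric] by (simp only: mem_Collect_eq)
  moreover have "set [1..<Suc (length \<pi>)] = {1..length \<pi>}"
    by (simp only: set_upt atLeastLessThanSuc_atLeastAtMost)
  ultimately have "{i. i \<le> \<pi> ! (i - 1)} \<inter> set [1..<Suc (length \<pi>)] = {i. 1 \<le> i \<and> i \<le> N i}"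
    unfolding set_eq_iff Int_iff mem_Collect_eq atLeastAtMost_iff by blast
  then show ?thesis by (simp only: alpha_eq length_map distinct_length_filter distinct_upt)
qed

lemma length_beta: "length (beta \<pi>) = card {j. 1 \<le> j \<and> j < N j}"
proof -
  have "j \<le> num_columns \<pi>" if "j < N j" for j
  proof -
    from that have "filter (\<lambda>d. j \<le> d) \<pi> \<noteq> []" by (auto simp: N_def)
    then obtain d where "d \<in> set \<pi>" "j \<le> d" by (auto simp: filter_empty_conv)
    then show ?thesis using le_num_columns order_trans by blast
  qed
  moreover have "set [1..<Suc (num_columns \<pi>)] = {1..num_columns \<pi>}"
    by (simp only: set_upt atLeastLessThanSuc_atLeastAtMost)
  ultimately have "{j. j < N j} \<inter> set [1..<Suc (num_columns \<pi>)] = {j. 1 \<le> j \<and> j < N j}"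
    by (auto simp only: atLeastAtMost_iff)
  then show ?thesis
    by (simp only: beta_eq[OF sorted] ferrers_column length_map distinct_length_filter distinct_upt
        card_atLeastAtMost diff_Suc_1)
qed

end

lemma length_filter_degree_sequence:
  assumes "finite V"
  shows "length (filter P (degree_sequence V E)) = card {v \<in> V. P (degree E v)}"
proof -
  have "length (filter P (degree_sequence V E)) = size (filter_mset P (mset (degree_sequence V E)))"
    by (simp flip: mset_filter)
  also have "\<dots> = size (filter_mset (\<lambda>v. P (degree E v)) (mset_set V))"
    by (simp add: degree_sequence_def filter_mset_image_mset)
  finally show ?thesis using assms by simp
qed

section \<open>Largest cliques and stable sets of a split graph\<close>

lemma Max_card_subsets_ge: "finite V \<Longrightarrow> C \<subseteq> V \<Longrightarrow> P C \<Longrightarrow> card C \<le> Max (card ` {C. C \<subseteq> V \<and> P C})"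
  by (rule Max_ge) auto

lemma Max_card_subsets_attained:
  assumes "finite V" "P {}"
  obtains C where "C \<subseteq> V" "P C" "card C = Max (card ` {C. C \<subseteq> V \<and> P C})"
proof -
  have "Max (card ` {C. C \<subseteq> V \<and> P C}) \<in> card ` {C. C \<subseteq> V \<and> P C}"
    using assms by (intro Max_in) auto
  then show ?thesis using that by auto
qed

lemma card_clique_Int_indep_le_1:
  assumes "finite A" "clique A E" "indep B E"
  shows "card (A \<inter> B) \<le> 1"
  using assms by (subst card_le_Suc0_iff_eq[unfolded One_nat_def[symmetric]])
    (auto simp: clique_def indep_def)

text \<open>
  A set that meets \<open>B\<close> in at most one point exceeds the size of \<open>A\<close> only by containing all of \<open>A\<close>.
  With \<open>A\<close> one side of a KS-partition and \<open>B\<close> the other, this applies to cliques and to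
  stable sets alike.
\<close>

lemma larger_set_is_insert:
  assumes "finite A" "finite B" "C \<subseteq> A \<union> B" "A \<inter> B = {}" "card (C \<inter> B) \<le> 1" "card A < card C"
  obtains b where "b \<in> B" "C = insert b A"
proof -
  have C: "C = (C \<inter> A) \<union> (C \<inter> B)" using assms(3) by blast
  have "card C = card (C \<inter> A) + card (C \<inter> B)"
    by (subst C, rule card_Un_disjoint) (use assms in auto)
  moreover have "card (C \<inter> A) \<le> card A" using assms by (simp add: card_mono)
  ultimately have "card (C \<inter> A) = card A" "card (C \<inter> B) = 1" using assms(5,6) by auto
  then obtain b where "C \<inter> A = A" "C \<inter> B = {b}"
    using card_subset_eq[OF assms(1), of "C \<inter> A"] by (auto simp: card_1_singleton_iff)
  then show ?thesis using that[of b] C by blast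
qed

lemma split_graph_finite: "split_graph V E \<Longrightarrow> finite V"
  by (simp add: split_graph_def simple_graph_def)

lemma KS_partition_finite:
  assumes "finite V" "KS_partition V E K S"
  shows "finite K" "finite S"
  using assms by (auto simp: KS_partition_def)

text \<open>
  If the clique side of a KS-partition is not a largest clique, then a largest clique is that side
  together with a vertex of \<open>S\<close>, and moving this vertex across gives the partition wanted.
\<close>

lemma K_max_partition_exists:
  assumes "split_graph V E"
  obtains K S where "K_max V E K S"
proof -
  have V: "finite V" using assms by (rule split_graph_finite)
  obtain K S where KS: "KS_partition V E K S" using assms by (auto simp: split_graph_def)
  note fin = KS_partition_finite[OF V KS]
  obtain C where C: "C \<subseteq> V" "clique C E" "card C = clique_number V E"
    unfolding clique_number_def
    by (rule Max_card_subsets_attained[OF V, of "\<lambda>C. clique C E"]) (auto simp: clique_def)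
  have "card K \<le> clique_number V E"
    unfolding clique_number_def by (rule Max_card_subsets_ge) (use V KS in \<open>auto simp: KS_partition_def\<close>)
  then consider "card K = clique_number V E" | "card K < card C" using C by linarith
  then show ?thesis
  proof cases
    case 1
    then show ?thesis using that KS by (auto simp: K_max_def)
  next
    case 2
    have "card (C \<inter> S) \<le> 1"
      using card_clique_Int_indep_le_1[OF finite_subset[OF C(1) V] C(2)] KS
      by (simp add: KS_partition_def)
    with 2 obtain s where "s \<in> S" "C = insert s K"
      using larger_set_is_insert[OF fin, of C] C KS by (auto simp: KS_partition_def)
    then have "KS_partition V E C (S - {s})"
      using KS C(2) by (auto simp: KS_partition_def indep_def)
    then show ?thesis using that C by (auto simp: K_max_def)
  qed
qed

lemma stable_side_is_max_iff:
  assumes V: "finite V" and KS: "KS_partition V E K S"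
  shows "card S = stability_number V E \<longleftrightarrow> \<not> (\<exists>v\<in>K. indep (insert v S) E)"
proof
  note fin = KS_partition_finite[OF V KS]
  assume S: "card S = stability_number V E"
  show "\<not> (\<exists>v\<in>K. indep (insert v S) E)"
  proof
    assume "\<exists>v\<in>K. indep (insert v S) E"
    then obtain v where v: "v \<in> K" "indep (insert v S) E" by blast
    then have "card (insert v S) \<le> stability_number V E"
      unfolding stability_number_def
      by (intro Max_card_subsets_ge) (use V KS in \<open>auto simp: KS_partition_def\<close>)
    moreover have "v \<notin> S" using v KS by (auto simp: KS_partition_def)
    ultimately show False using S fin by simp
  qed
next
  note fin = KS_partition_finite[OF V KS]
  assume no_swing: "\<not> (\<exists>v\<in>K. indep (insert v S) E)"
  obtain I where I: "I \<subseteq> V" "indep I E" "card I = stability_number V E"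
    unfolding stability_number_def
    by (rule Max_card_subsets_attained[OF V, of "\<lambda>I. indep I E"]) (auto simp: indep_def)
  have "card S \<le> stability_number V E"
    unfolding stability_number_def by (rule Max_card_subsets_ge) (use V KS in \<open>auto simp: KS_partition_def\<close>)
  moreover have "\<not> card S < card I"
  proof
    assume "card S < card I"
    moreover have "card (I \<inter> K) \<le> 1"
      using card_clique_Int_indep_le_1[OF fin(1), of E I] I KS by (auto simp: KS_partition_def Int_commute)
    ultimately obtain v where "v \<in> K" "I = insert v S"
      using larger_set_is_insert[OF fin(2,1), of I] I KS by (auto simp: KS_partition_def)
    with no_swing I show False by blast
  qed
  ultimately show "card S = stability_number V E" using I by simp
qed

text \<open>
  Being balanced asks for one suitable partition, but its stable side has \<open>card V - clique_number V E\<close>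
  vertices, as in every partition with a largest clique. So any one such partition decides.
\<close>

lemma balanced_iff_no_swing_vertex:
  assumes "split_graph V E" and KS: "K_max V E K S"
  shows "balanced V E \<longleftrightarrow> \<not> (\<exists>v\<in>K. indep (insert v S) E)"
proof -
  have V: "finite V" using assms by (simp add: split_graph_finite)
  have card_S: "card S' = card V - clique_number V E" if "K_max V E K' S'" for K' S'
  proof -
    have "KS_partition V E K' S'" using that by (simp add: K_max_def)
    from KS_partition_finite[OF V this] this
    have "card V = card K' + card S'" by (auto simp: KS_partition_def card_Un_disjoint)
    then show ?thesis using that by (simp add: K_max_def)
  qed
  have part: "KS_partition V E K S" using KS by (simp add: K_max_def)
  have "balanced V E \<longleftrightarrow> card S = stability_number V E"
    using assms card_S part unfolding balanced_def S_max_def by metis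
  then show ?thesis using stable_side_is_max_iff[OF V part] by simp
qed

section \<open>Degrees in a split graph\<close>

context
  fixes V :: "'a set" and E :: "'a set set" and K S :: "'a set"
  assumes G: "simple_graph V E" and KS: "K_max V E K S"
begin

private lemma partition: "KS_partition V E K S"
  using KS by (simp add: K_max_def)

private lemma finite_sides: "finite V" "finite K" "finite S"
  using G KS_partition_finite[OF _ partition] by (auto simp: simple_graph_def)

private lemma neighbours_subset: "{w. {v, w} \<in> E} \<subseteq> K \<union> S - {v}"
proof -
  have "v \<noteq> w" "w \<in> V" if "{v, w} \<in> E" for w
    using that G by (auto simp: simple_graph_def nsets_def)
  then show ?thesis using partition by (auto simp: KS_partition_def)
qed

private lemma finite_neighbours: "finite {w. {v, w} \<in> E}"
  using neighbours_subset by (rule finite_subset) (use finite_sides in simp)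

private lemma neighbours_clique_side:
  assumes "v \<in> K"
  shows "{w. {v, w} \<in> E} = (K - {v}) \<union> {w \<in> S. {v, w} \<in> E}"
proof -
  have "\<forall>w\<in>K - {v}. {v, w} \<in> E" using assms partition by (auto simp: KS_partition_def clique_def)
  then show ?thesis using neighbours_subset[of v] by blast
qed

lemma degree_clique_side_ge: "card K - 1 \<le> degree E v" if "v \<in> K"
proof -
  have "card (K - {v}) \<le> degree E v"
    unfolding degree_def
    by (rule card_mono[OF finite_neighbours]) (use neighbours_clique_side[OF that] in blast)
  then show ?thesis using that by simp
qed

text \<open>
  A vertex of \<open>K\<close> is joined to the rest of \<open>K\<close>, so its degree is \<open>card K - 1\<close> plus the number of its
  neighbours in \<open>S\<close>.
\<close>

lemma degree_clique_side_less_iff: "degree E v < card K \<longleftrightarrow> indep (insert v S) E" if v: "v \<in> K"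
proof -
  have disj: "(K - {v}) \<inter> {w \<in> S. {v, w} \<in> E} = {}"
    using partition by (auto simp: KS_partition_def)
  have "degree E v = card (K - {v}) + card {w \<in> S. {v, w} \<in> E}"
    unfolding degree_def neighbours_clique_side[OF v] using finite_sides disj
    by (intro card_Un_disjoint) auto
  moreover have "card K = Suc (card (K - {v}))" using v finite_sides by (intro card.remove)
  ultimately have "degree E v < card K \<longleftrightarrow> {w \<in> S. {v, w} \<in> E} = {}"
    using finite_sides by auto
  also have "\<dots> \<longleftrightarrow> indep (insert v S) E"
    using partition v by (auto simp: KS_partition_def indep_def insert_commute)
  finally show ?thesis .
qed

text \<open>A vertex of \<open>S\<close> has all its neighbours in \<open>K\<close>, and not all of \<open>K\<close> by maximality.\<close>

lemma degree_stable_side_less: "degree E v < card K" if v: "v \<in> S"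
proof -
  have "\<forall>w\<in>S - {v}. {v, w} \<notin> E"
    using v partition by (auto simp: KS_partition_def indep_def)
  then have "{w. {v, w} \<in> E} \<subseteq> K" using neighbours_subset[of v] by blast
  moreover have "{w. {v, w} \<in> E} \<noteq> K"
  proof
    assume "{w. {v, w} \<in> E} = K"
    then have "{v, w} \<in> E" "{w, v} \<in> E" if "w \<in> K" for w
      using that by (auto simp: insert_commute)
    then have "clique (insert v K) E"
      using partition unfolding KS_partition_def clique_def by blast
    then have "card (insert v K) \<le> clique_number V E"
      unfolding clique_number_def using v partition finite_sides
      by (intro Max_card_subsets_ge) (auto simp: KS_partition_def)
    moreover have "v \<notin> K" using v partition by (auto simp: KS_partition_def)
    ultimately show False using KS finite_sides by (simp add: K_max_def)
  qed
  ultimately show ?thesis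
    unfolding degree_def using finite_sides by (intro psubset_card_mono) auto
qed

lemma clique_side_nonempty: "0 < card K"
proof -
  obtain v where "v \<in> V" using G by (auto simp: simple_graph_def)
  then have "card {v} \<le> clique_number V E"
    unfolding clique_number_def using finite_sides
    by (intro Max_card_subsets_ge) (auto simp: clique_def)
  then show ?thesis using KS by (simp add: K_max_def)
qed

lemma degree_ge_card_iff:
  "{v \<in> V. card K \<le> degree E v} = {v \<in> K. \<not> indep (insert v S) E}"
proof -
  have "V = K \<union> S" using partition by (simp add: KS_partition_def)
  then show ?thesis
    using degree_clique_side_less_iff degree_stable_side_less unfolding not_less[symmetric] by blast
qed

text \<open>
  The function \<open>N\<close> crosses the diagonal at \<open>card K\<close>: it is at least \<open>card K\<close> before that point and at
  most \<open>card K\<close> from there on. Only row \<open>card K\<close> is left open, and it reaches the diagonal iff all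
  vertices of \<open>K\<close> have a neighbour in \<open>S\<close>.
\<close>

lemma length_alpha_eq_length_beta_iff:
  "length (alpha (degree_sequence V E)) = length (beta (degree_sequence V E))
    \<longleftrightarrow> (\<exists>v\<in>K. indep (insert v S) E)"
proof -
  define N where "N j = card {v \<in> V. j \<le> degree E v}" for j
  have antitone: "N j \<le> N i" if "i \<le> j" for i j
    unfolding N_def using that finite_sides by (intro card_mono) auto
  have "card K \<le> N (card K - 1)"
    unfolding N_def using partition degree_clique_side_ge finite_sides
    by (intro card_mono) (auto simp: KS_partition_def)
  then have low: "card K \<le> N j" if "j < card K" for j
    using that antitone[of j "card K - 1"] by linarith
  have Nk: "N (card K) = card {v \<in> K. \<not> indep (insert v S) E}"
    by (simp add: N_def degree_ge_card_iff)
  also have "\<dots> \<le> card K" using finite_sides by (intro card_mono) auto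
  finally have high: "N j \<le> card K" if "card K \<le> j" for j
    using that antitone[of "card K" j] by linarith
  have beta: "j < N j \<longleftrightarrow> j < card K" for j
    using low[of j] high[of j] by linarith
  have alpha: "i \<le> N i \<longleftrightarrow> i < card K \<or> i = card K \<and> N (card K) = card K" for i
    using low[of i] high[of i] by (cases i "card K" rule: linorder_cases) auto
  have len_beta: "length (beta (degree_sequence V E)) = card {1..<card K}"
  proof -
    have "{j. 1 \<le> j \<and> j < N j} = {1..<card K}"
      unfolding beta by (intro set_eqI) (simp only: mem_Collect_eq atLeastLessThan_iff)
    then show ?thesis
      using length_beta[OF sorted_degree_sequence, of V E]
      by (simp only: length_filter_degree_sequence[OF finite_sides(1)] flip: N_def)
  qed
  have "length (alpha (degree_sequence V E))
      = card (if N (card K) = card K then {1..card K} else {1..<card K})"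
  proof -
    have "{i. 1 \<le> i \<and> i \<le> N i} = (if N (card K) = card K then {1..card K} else {1..<card K})"
      using clique_side_nonempty by (auto simp: alpha)
    then show ?thesis
      using length_alpha[OF sorted_degree_sequence, of V E]
      by (simp only: length_filter_degree_sequence[OF finite_sides(1)] flip: N_def)
  qed
  then have "length (alpha (degree_sequence V E)) = length (beta (degree_sequence V E))
      \<longleftrightarrow> N (card K) \<noteq> card K"
    using clique_side_nonempty len_beta by auto
  also have "\<dots> \<longleftrightarrow> {v \<in> K. \<not> indep (insert v S) E} \<noteq> K"
    using card_subset_eq[OF finite_sides(2), of "{v \<in> K. \<not> indep (insert v S) E}"]
    unfolding Nk by auto
  also have "\<dots> \<longleftrightarrow> (\<exists>v\<in>K. indep (insert v S) E)" by auto
  finally show ?thesis .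
qed

end

section \<open>Balance from the degree sequence\<close>

theorem theorem2p2:
  fixes V :: "'a set" and E :: "'a set set" and \<pi> :: "nat list"
  assumes "split_graph V E"
    and "\<forall>v\<in>V. \<not> isolated E v"
    and "\<pi> = degree_sequence V E"
  shows "(length (alpha \<pi>) = length (beta \<pi>) \<longrightarrow> unbalanced V E) \<and>
         (length (alpha \<pi>) \<noteq> length (beta \<pi>) \<longrightarrow> balanced V E)"
proof -
  have "simple_graph V E" using assms(1) by (simp add: split_graph_def)
  moreover obtain K S where KS: "K_max V E K S"
    using assms(1) by (rule K_max_partition_exists)
  ultimately have "length (alpha \<pi>) = length (beta \<pi>) \<longleftrightarrow> \<not> balanced V E"
    using length_alpha_eq_length_beta_iff balanced_iff_no_swing_vertex[OF assms(1) KS] assms(3)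
    by blast
  then show ?thesis using assms(1) by (simp add: unbalanced_def)
qed

end
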